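(* Let $G$ and $H$ be two graphs. Then the join $G\vee H$ satisfies: (1) if neither $G$ nor $H$ is a complete graph, then $CC(G\vee H)=|V(G)|+|V(H)|$; (2) if one of $G$ and $H$ is a complete graph and the other has connected coalition number $0$, then $CC(G\vee H)=0$; (3) in all other cases, $CC(G\vee H)=CC(G)+CC(H)$.
   Context: All graphs are finite and simple, with nonempty vertex set. The join $G\vee H$ is the graph obtained from disjoint copies of $G$ and $H$ by joining every vertex of $G$ to every vertex of $H$. A full vertex of $G$ is a vertex of degree $|V(G)|-1$. A set $S\subseteq V(G)$ is a dominating set of $G$ if every vertex of $V(G)\setminus S$ has a neighbour in $S$; it is a connected dominating set if moreover the induced subgraph $G[S]$ is connected. Two disjoint vertex sets $A_1,A_2$ form a connected coalition of $G$ if $A_1\cup A_2$ is a connected dominating set of $G$ but neither $A_1$ nor $A_2$ is a connected dominating set of $G$. A connected coalition partition of $G$ is a partition $\Phi$ of $V(G)$ (into nonempty sets) such that each $A\in\Phi$ either is $\{v\}$ for some full vertex $v$ of $G$, or forms a connected coalition of $G$ with another set in $\Phi$. The connected coalition number $CC(G)$ is the maximum cardinality of a connected coalition partition of $G$, with $CC(G)=0$ if none exists. *)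

theory Defs
  imports "Graph_Theory.Graph_Theory" "HOL-Library.Disjoint_Sets"
begin

(* Finite simple graphs are the symmetric loop-free digraphs "pair_graph" of Graph_Theory: an
   edge uv is stored as the two arcs (u,v) and (v,u), so the degree of v is its out-degree.
   "pair_graph" admits the null graph, which "simple_graph" excludes. *)

definition simple_graph :: "'a pair_pre_digraph \<Rightarrow> bool" where
  "simple_graph G \<longleftrightarrow> pair_graph G \<and> pverts G \<noteq> {}"

definition complete_graph :: "'a pair_pre_digraph \<Rightarrow> bool" where
  "complete_graph G \<longleftrightarrow> complete_digraph (card (pverts G)) (with_proj G)"

definition graph_join ::
    "'a pair_pre_digraph \<Rightarrow> 'b pair_pre_digraph \<Rightarrow> ('a + 'b) pair_pre_digraph" where
  "graph_join G H = \<lparr>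
     pverts = pverts G <+> pverts H,
     parcs = map_prod Inl Inl ` parcs G \<union> map_prod Inr Inr ` parcs H
       \<union> (Inl ` pverts G) \<times> (Inr ` pverts H) \<union> (Inr ` pverts H) \<times> (Inl ` pverts G) \<rparr>"

definition full_vertex :: "'a pair_pre_digraph \<Rightarrow> 'a \<Rightarrow> bool" where
  "full_vertex G v \<longleftrightarrow> v \<in> pverts G \<and> out_degree (with_proj G) v = card (pverts G) - 1"

definition dominating_set :: "'a pair_pre_digraph \<Rightarrow> 'a set \<Rightarrow> bool" where
  "dominating_set G S \<longleftrightarrow> S \<subseteq> pverts G \<and> (\<forall>v \<in> pverts G - S. \<exists>u \<in> S. (v, u) \<in> parcs G)"

definition connected_dominating_set :: "'a pair_pre_digraph \<Rightarrow> 'a set \<Rightarrow> bool" where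
  "connected_dominating_set G S \<longleftrightarrow>
     dominating_set G S \<and> Digraph_Component.connected (with_proj G \<restriction> S)"

definition connected_coalition :: "'a pair_pre_digraph \<Rightarrow> 'a set \<Rightarrow> 'a set \<Rightarrow> bool" where
  "connected_coalition G A B \<longleftrightarrow>
     A \<subseteq> pverts G \<and> B \<subseteq> pverts G \<and> A \<inter> B = {} \<and>
     connected_dominating_set G (A \<union> B) \<and>
     \<not> connected_dominating_set G A \<and> \<not> connected_dominating_set G B"

definition connected_coalition_partition ::
    "'a pair_pre_digraph \<Rightarrow> 'a set set \<Rightarrow> bool" where
  "connected_coalition_partition G P \<longleftrightarrow>
     partition_on (pverts G) P \<and>
     (\<forall>A \<in> P. (\<exists>v. full_vertex G v \<and> A = {v}) \<or> (\<exists>B \<in> P. B \<noteq> A \<and> connected_coalition G A B))"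

definition connected_coalition_number :: "'a pair_pre_digraph \<Rightarrow> nat" where
  "connected_coalition_number G =
     (if \<exists>P. connected_coalition_partition G P
      then Max (card ` {P. connected_coalition_partition G P}) else 0)"

end

theory Submission
  imports Defs
begin

(* If neither graph is complete, the partition into singletons works: two non-full vertices on
   different sides are adjacent and together dominate the join.  If one graph is complete, all of
   its vertices are full in the join.  A set properly containing a full vertex, and hence itself
   connected dominating, cannot be a class of a connected coalition partition, so the full vertices
   are singleton classes and the remaining classes form a connected coalition partition of the
   other graph. *)

section \<open>Simple graphs, full vertices and connected domination\<close>

lemma simple_graphD:
  assumes "simple_graph G"
  shows "finite (pverts G)" "pverts G \<noteq> {}"
    "(u, v) \<in> parcs G \<Longrightarrow> u \<in> pverts G" "(u, v) \<in> parcs G \<Longrightarrow> v \<in> pverts G"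
    "(u, v) \<in> parcs G \<Longrightarrow> u \<noteq> v" "(u, v) \<in> parcs G \<Longrightarrow> (v, u) \<in> parcs G"
proof -
  interpret pair_graph G using assms by (simp add: simple_graph_def)
  show "finite (pverts G)" "pverts G \<noteq> {}"
    "(u, v) \<in> parcs G \<Longrightarrow> u \<in> pverts G" "(u, v) \<in> parcs G \<Longrightarrow> v \<in> pverts G"
    "(u, v) \<in> parcs G \<Longrightarrow> u \<noteq> v" "(u, v) \<in> parcs G \<Longrightarrow> (v, u) \<in> parcs G"
    using assms wellformed' no_loops' arcs_symmetric by (auto simp: simple_graph_def)
qed

lemma simple_graphI:
  assumes "finite (pverts G)" "pverts G \<noteq> {}"
    and arcs: "\<And>u v. (u, v) \<in> parcs G \<Longrightarrow>
      u \<in> pverts G \<and> v \<in> pverts G \<and> u \<noteq> v \<and> (v, u) \<in> parcs G"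
  shows "simple_graph G"
proof -
  have "finite (parcs G)"
    by (rule finite_subset[of _ "pverts G \<times> pverts G"]) (use assms(1) arcs in auto)
  with assms have "pair_graph G"
    by unfold_locales (force simp: symmetric_def intro: symI)+
  with assms(2) show ?thesis by (simp add: simple_graph_def)
qed

text \<open>The neighbours of \<open>v\<close> lie in \<open>pverts G - {v}\<close>, a finite set of
  cardinality \<open>card (pverts G) - 1\<close>, so having that degree forces equality of the two
  sets.\<close>

lemma full_vertex_iff:
  assumes "simple_graph G"
  shows "full_vertex G v \<longleftrightarrow> v \<in> pverts G \<and> (\<forall>u \<in> pverts G. u \<noteq> v \<longrightarrow> (v, u) \<in> parcs G)"
proof (cases "v \<in> pverts G")
  case True
  let ?N = "{u. (v, u) \<in> parcs G}"
  note G = simple_graphD[OF assms]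
  have sub: "?N \<subseteq> pverts G - {v}"
    using G(4,5) by blast
  have "out_arcs (with_proj G) v = Pair v ` ?N"
    by (auto simp: out_arcs_def)
  then have "out_degree (with_proj G) v = card ?N"
    by (simp add: out_degree_def card_image inj_on_def)
  moreover have "card (pverts G - {v}) = card (pverts G) - 1"
    using True by simp
  moreover have "card ?N = card (pverts G - {v}) \<longleftrightarrow> ?N = pverts G - {v}"
    using G(1) sub by (metis card_subset_eq finite_Diff)
  ultimately show ?thesis
    using True sub by (auto simp: full_vertex_def)
qed (simp add: full_vertex_def)

lemma complete_graph_iff:
  assumes "simple_graph G"
  shows "complete_graph G \<longleftrightarrow> (\<forall>v \<in> pverts G. full_vertex G v)"
  unfolding complete_graph_def complete_digraph_pair_def full_vertex_iff[OF assms]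
  using simple_graphD(1,3-5)[OF assms] by blast

text \<open>Connectivity is strong connectivity of the symmetric closure. Arcs of a simple graph are
  already symmetric, so the closure adds nothing, and \<open>rtrancl_on S\<close> confines walks to
  \<open>S\<close> as inducing does. Nonemptiness is part of strong connectivity, so the empty set
  is never connected.\<close>

lemma connected_induce_iff:
  assumes "simple_graph G"
  shows "Digraph_Component.connected (with_proj G \<restriction> S) \<longleftrightarrow>
    S \<noteq> {} \<and> (\<forall>u \<in> S. \<forall>v \<in> S. (u, v) \<in> rtrancl_on S (parcs G))"
proof -
  let ?R = "parcs (mk_symmetric (with_proj G \<restriction> S))"
  have R: "?R = parcs G \<inter> S \<times> S"
    using simple_graphD(6)[OF assms] by (auto simp: mk_symmetric_def)
  have "(u, v) \<in> rtrancl_on S ?R" if "(u, v) \<in> rtrancl_on S (parcs G)" for u v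
    using that by induction (auto simp: R intro: converse_rtrancl_on_into_rtrancl_on)
  moreover have "(u, v) \<in> rtrancl_on S (parcs G)" if "(u, v) \<in> rtrancl_on S ?R" for u v
    using rtrancl_on_mono[OF _ subset_refl that, of "parcs G"] R by auto
  ultimately show ?thesis
    by (auto simp: Digraph_Component.connected_def strongly_connected_def reachable_def)
qed

lemma connected_dominating_set_iff:
  assumes "simple_graph G"
  shows "connected_dominating_set G S \<longleftrightarrow>
    S \<noteq> {} \<and> S \<subseteq> pverts G \<and> (\<forall>v \<in> pverts G - S. \<exists>u \<in> S. (v, u) \<in> parcs G) \<and>
    (\<forall>u \<in> S. \<forall>v \<in> S. (u, v) \<in> rtrancl_on S (parcs G))"
  by (auto simp: connected_dominating_set_def dominating_set_def connected_induce_iff[OF assms])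

text \<open>Any two vertices of \<open>S\<close> are linked by a walk through \<open>v\<close>, and
  \<open>v\<close> alone already dominates.\<close>

lemma connected_dominating_set_if_full_vertex:
  assumes G: "simple_graph G" and v: "full_vertex G v" "v \<in> S" and S: "S \<subseteq> pverts G"
  shows "connected_dominating_set G S"
proof -
  have adj: "(v, u) \<in> parcs G" "(u, v) \<in> parcs G" if "u \<in> pverts G" "u \<noteq> v" for u
    using v that full_vertex_iff[OF G] simple_graphD(6)[OF G] by auto
  have out: "(v, u) \<in> rtrancl_on S (parcs G)" if "u \<in> S" for u
    using adj(1)[of u] that v(2) S by (cases "u = v") (auto intro: rtrancl_on_into_rtrancl_on)
  have into: "(u, v) \<in> rtrancl_on S (parcs G)" if "u \<in> S" for u
    using adj(2)[of u] that v(2) S by (cases "u = v") (auto intro: rtrancl_on_into_rtrancl_on)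
  show ?thesis
    unfolding connected_dominating_set_iff[OF G]
    using v(2) S adj(2) rtrancl_on_trans[OF into out] by blast
qed

lemma connected_dominating_set_singleton_iff:
  assumes "simple_graph G"
  shows "connected_dominating_set G {v} \<longleftrightarrow> full_vertex G v"
proof
  assume "connected_dominating_set G {v}"
  then show "full_vertex G v"
    using simple_graphD(6)[OF assms]
    by (auto simp: connected_dominating_set_iff[OF assms] full_vertex_iff[OF assms])
next
  assume "full_vertex G v"
  then show "connected_dominating_set G {v}"
    by (intro connected_dominating_set_if_full_vertex[OF assms]) (auto simp: full_vertex_def)
qed

section \<open>Coalition partitions and their maximum cardinality\<close>

lemma connected_coalition_partition_full_vertex:
  assumes G: "simple_graph G" and P: "connected_coalition_partition G P"
    and v: "full_vertex G v"
  shows "{v} \<in> P"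
proof -
  have "v \<in> \<Union>P"
    using P v by (auto simp: connected_coalition_partition_def partition_on_def full_vertex_def)
  then obtain A where A: "A \<in> P" "v \<in> A" by blast
  then have "A \<subseteq> pverts G"
    using P by (auto simp: connected_coalition_partition_def partition_on_def)
  \<comment> \<open>The class \<open>A\<close> is itself connected dominating and so has no partner;
    only the singleton alternative remains.\<close>
  then have "\<not> connected_coalition G A B" for B
    using connected_dominating_set_if_full_vertex[OF G v A(2)]
    by (auto simp: connected_coalition_def)
  then show ?thesis
    using A P by (auto simp: connected_coalition_partition_def)
qed

lemma finite_connected_coalition_partitions:
  assumes "simple_graph G"
  shows "finite {P. connected_coalition_partition G P}"
proof (rule finite_subset)
  show "{P. connected_coalition_partition G P} \<subseteq> Pow (Pow (pverts G))"
    by (auto simp: connected_coalition_partition_def partition_on_def)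
qed (use simple_graphD(1)[OF assms] in simp)

lemma card_partition_on_le:
  assumes "finite V" "partition_on V P"
  shows "card P \<le> card V"
proof (rule surj_card_le[OF assms(1)])
  \<comment> \<open>Sending each vertex to its class maps \<open>V\<close> onto \<open>P\<close>,
    since classes are nonempty.\<close>
  show "P \<subseteq> (\<lambda>v. THE A. A \<in> P \<and> v \<in> A) ` V"
  proof
    fix A assume A: "A \<in> P"
    then have "A \<noteq> {}" "A \<subseteq> V"
      using assms(2) by (auto simp: partition_on_def)
    then obtain v where v: "v \<in> A" "v \<in> V" by blast
    have "(THE A. A \<in> P \<and> v \<in> A) = A"
      using A v assms(2)
      by (intro the_equality) (auto simp: partition_on_def disjoint_def)
    with v show "A \<in> (\<lambda>v. THE A. A \<in> P \<and> v \<in> A) ` V" by blast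
  qed
qed

text \<open>The default value 0 never collides with a true maximum: a partition of a nonempty vertex
  set has at least one class.\<close>

lemma connected_coalition_number_eq_0_iff:
  assumes "simple_graph G"
  shows "connected_coalition_number G = 0 \<longleftrightarrow> (\<nexists>P. connected_coalition_partition G P)"
proof -
  note G = simple_graphD[OF assms]
  have "0 < card P" if P: "connected_coalition_partition G P" for P
  proof -
    have "finite P" "P \<noteq> {}"
      using P G(1,2) by (auto simp: connected_coalition_partition_def finite_elements
          partition_on_def finite_UnionD)
    then show ?thesis by (simp add: card_gt_0_iff)
  qed
  then have "0 < Max (card ` {P. connected_coalition_partition G P})"
    if "connected_coalition_partition G P" for P
    using that finite_connected_coalition_partitions[OF assms] by (subst Max_gr_iff) auto
  then show ?thesis
    by (auto simp: connected_coalition_number_def)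
qed

text \<open>No partition has more classes than there are vertices, and the singletons attain this
  bound.\<close>

lemma connected_coalition_number_eq_card:
  assumes G: "simple_graph G" and *: "connected_coalition_partition G ((\<lambda>v. {v}) ` pverts G)"
  shows "connected_coalition_number G = card (pverts G)"
proof -
  let ?X = "{P. connected_coalition_partition G P}"
  have "Max (card ` ?X) = card (pverts G)"
  proof (rule Max_eqI)
    show "finite (card ` ?X)"
      using finite_connected_coalition_partitions[OF G] by simp
    show "k \<le> card (pverts G)" if "k \<in> card ` ?X" for k
      using that card_partition_on_le[OF simple_graphD(1)[OF G]]
      by (auto simp: connected_coalition_partition_def)
    have "card ((\<lambda>v. {v}) ` pverts G) = card (pverts G)"
      by (simp add: card_image)
    then show "card (pverts G) \<in> card ` ?X"
      using * by (metis imageI mem_Collect_eq)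
  qed
  with * show ?thesis by (auto simp: connected_coalition_number_def)
qed

lemma connected_coalition_partition_singletons:
  assumes "simple_graph G"
    and "\<And>v. v \<in> pverts G \<Longrightarrow> \<not> full_vertex G v \<Longrightarrow>
      \<exists>w \<in> pverts G. \<not> full_vertex G w \<and> connected_dominating_set G {v, w}"
  shows "connected_coalition_partition G ((\<lambda>v. {v}) ` pverts G)"
proof -
  have "\<exists>B \<in> (\<lambda>v. {v}) ` pverts G. B \<noteq> {v} \<and> connected_coalition G {v} B"
    if v: "v \<in> pverts G" "\<not> full_vertex G v" for v
  proof -
    obtain w where w: "w \<in> pverts G" "\<not> full_vertex G w" "connected_dominating_set G {v, w}"
      using assms(2)[OF v] by blast
    \<comment> \<open>Otherwise \<open>{v, w}\<close> collapses to \<open>{v}\<close>, and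
      \<open>v\<close> would be full.\<close>
    then have "w \<noteq> v"
      using v connected_dominating_set_singleton_iff[OF assms(1)] by auto
    with v w have "connected_coalition G {v} {w}"
      by (auto simp: connected_coalition_def connected_dominating_set_singleton_iff[OF assms(1)]
          insert_commute)
    with w \<open>w \<noteq> v\<close> show ?thesis by blast
  qed
  then show ?thesis
    by (auto simp: connected_coalition_partition_def partition_on_def disjoint_def)
qed

lemma connected_coalition_number_complete_graph:
  assumes "simple_graph G" "complete_graph G"
  shows "connected_coalition_number G = card (pverts G)"
proof -
  have "connected_coalition_partition G ((\<lambda>v. {v}) ` pverts G)"
    \<comment> \<open>Every vertex is full, so no coalition partner has to be supplied.\<close>
    using assms complete_graph_iff[OF assms(1)]
    by (intro connected_coalition_partition_singletons[OF assms(1)]) blast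
  then show ?thesis
    by (rule connected_coalition_number_eq_card[OF assms(1)])
qed

section \<open>Adding full vertices to a graph\<close>

lemma rtrancl_on_image_iff:
  assumes f: "inj f" and rs: "\<And>x y. (f x, f y) \<in> r \<longleftrightarrow> (x, y) \<in> s"
  shows "(f x, f y) \<in> rtrancl_on (f ` F) r \<longleftrightarrow> (x, y) \<in> rtrancl_on F s"
proof
  \<comment> \<open>The endpoint is generalised so that the induction can also carry preimages of
    the intermediate vertices.\<close>
  have "\<exists>b. v = f b \<and> (x, b) \<in> rtrancl_on F s" if "(f x, v) \<in> rtrancl_on (f ` F) r" for v
    using that
  proof (induction rule: rtrancl_on_induct)
    case base
    then show ?case using f by (auto simp: inj_image_mem_iff)
  next
    case (step u v)
    then obtain b c where "u = f b" "(x, b) \<in> rtrancl_on F s" "v = f c" "c \<in> F" by blast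
    with step(2) show ?case using rs by (blast intro: rtrancl_on_into_rtrancl_on)
  qed
  then show "(f x, f y) \<in> rtrancl_on (f ` F) r \<Longrightarrow> (x, y) \<in> rtrancl_on F s"
    using f by (auto dest: injD)
next
  assume "(x, y) \<in> rtrancl_on F s"
  then show "(f x, f y) \<in> rtrancl_on (f ` F) r"
    by induction (auto intro: converse_rtrancl_on_into_rtrancl_on[OF iffD2[OF rs]])
qed

(* J is, up to the embedding f, the join of H with a complete graph on U; f = Inl and f = Inr
   serve the two orders of the join. *)
locale full_extension =
  fixes J :: "'b pair_pre_digraph" and H :: "'a pair_pre_digraph" and f :: "'a \<Rightarrow> 'b"
    and U :: "'b set"
  assumes J: "simple_graph J" and H: "simple_graph H"
    and inj: "inj f"
    and verts: "pverts J = U \<union> f ` pverts H"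
    and disj: "U \<inter> f ` pverts H = {}"
    and arcs: "\<And>x y. (f x, f y) \<in> parcs J \<longleftrightarrow> (x, y) \<in> parcs H"
    and full: "\<And>u. u \<in> U \<Longrightarrow> full_vertex J u"
begin

text \<open>This map turns out to produce exactly the connected coalition partitions of
  \<open>J\<close> from those of \<open>H\<close>, since the vertices of \<open>U\<close> are forced
  to be singleton classes.\<close>

definition extend :: "'a set set \<Rightarrow> 'b set set" where
  "extend Q = (\<lambda>u. {u}) ` U \<union> (`) f ` Q"

lemma adjacent_full: "u \<in> U \<Longrightarrow> x \<in> pverts J \<Longrightarrow> x \<noteq> u \<Longrightarrow> (x, u) \<in> parcs J"
  using full full_vertex_iff[OF J] simple_graphD(6)[OF J] by blast

lemma full_vertex_image_iff:
  assumes "x \<in> pverts H"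
  shows "full_vertex J (f x) \<longleftrightarrow> full_vertex H x"
proof -
  have "(f x, u) \<in> parcs J" if "u \<in> U" for u
    using that assms disj verts by (intro adjacent_full) auto
  then show ?thesis
    using assms
    by (simp add: full_vertex_iff[OF J] full_vertex_iff[OF H] verts arcs ball_Un inj_eq[OF inj])
qed

text \<open>Vertices of \<open>U\<close> are adjacent to everything, so any nonempty
  \<open>f\<close> S\<open>dominates them; the rest of domination and all walks inside\<close>f
  \<open>S\<close> transfer along \<open>f\<close>. The empty set fails on both sides.\<close>

lemma connected_dominating_set_image_iff:
  assumes S: "S \<subseteq> pverts H"
  shows "connected_dominating_set J (f ` S) \<longleftrightarrow> connected_dominating_set H S"
proof -
  have "\<exists>y \<in> f ` S. (u, y) \<in> parcs J" if u: "u \<in> U" and ne: "S \<noteq> {}" for u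
  proof -
    obtain x where "x \<in> S" using ne by blast
    moreover from this have "f x \<in> pverts J" "f x \<noteq> u"
      using S disj u verts by auto
    ultimately show ?thesis
      using adjacent_full[OF u] simple_graphD(6)[OF J] by blast
  qed
  moreover have "pverts J - f ` S = U \<union> f ` (pverts H - S)"
    using S disj inj by (auto simp: verts inj_eq)
  ultimately have "S \<noteq> {} \<Longrightarrow> (\<forall>v \<in> pverts J - f ` S. \<exists>u \<in> f ` S. (v, u) \<in> parcs J) \<longleftrightarrow>
      (\<forall>v \<in> pverts H - S. \<exists>u \<in> S. (v, u) \<in> parcs H)"
    by (simp add: ball_Un arcs)
  then show ?thesis
    using S unfolding connected_dominating_set_iff[OF J] connected_dominating_set_iff[OF H]
    by (auto simp: rtrancl_on_image_iff[OF inj arcs] verts)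
qed

lemma connected_coalition_image_iff:
  assumes "A \<subseteq> pverts H" "B \<subseteq> pverts H"
  shows "connected_coalition J (f ` A) (f ` B) \<longleftrightarrow> connected_coalition H A B"
proof -
  have "f ` A \<inter> f ` B = {} \<longleftrightarrow> A \<inter> B = {}"
    using inj by (simp flip: image_Int)
  moreover have "connected_dominating_set J (f ` A \<union> f ` B) \<longleftrightarrow>
      connected_dominating_set H (A \<union> B)"
    using connected_dominating_set_image_iff[of "A \<union> B"] assms by (simp add: image_Un)
  ultimately show ?thesis
    using assms by (auto simp: connected_coalition_def connected_dominating_set_image_iff verts)
qed

lemma not_connected_coalition_full:
  assumes "u \<in> U"
  shows "\<not> connected_coalition J A {u}"
  using connected_dominating_set_singleton_iff[OF J] full[OF assms]
  by (auto simp: connected_coalition_def)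

lemma partition_on_extend_iff:
  assumes "\<Union>Q \<subseteq> pverts H"
  shows "partition_on (pverts J) (extend Q) \<longleftrightarrow> partition_on (pverts H) Q"
proof -
  have sub: "X \<subseteq> pverts H" if "X \<in> Q" for X using that assms by blast
  have "\<Union>(extend Q) = U \<union> f ` \<Union>Q"
    by (auto simp: extend_def)
  \<comment> \<open>This cancels \<open>U\<close> when the union of \<open>extend Q\<close> is
    compared with \<open>pverts J\<close>.\<close>
  moreover have "U \<union> X = U \<union> Y \<longleftrightarrow> X = Y" if "U \<inter> X = {}" "U \<inter> Y = {}" for X Y
    using that by blast
  moreover have "U \<inter> f ` \<Union>Q = {}"
    using assms disj by blast
  ultimately have "\<Union>(extend Q) = pverts J \<longleftrightarrow> f ` \<Union>Q = f ` pverts H"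
    using disj by (simp only: verts)
  then have "\<Union>(extend Q) = pverts J \<longleftrightarrow> \<Union>Q = pverts H"
    by (simp only: inj_image_eq_iff[OF inj])
  moreover have "{} \<in> extend Q \<longleftrightarrow> {} \<in> Q"
    by (auto simp: extend_def)
  moreover have "disjoint (extend Q) \<longleftrightarrow> disjoint Q"
  proof -
    have "disjoint ((\<lambda>u. {u}) ` U)"
      by (auto simp: disjoint_def)
    moreover have "\<Union>((\<lambda>u. {u}) ` U) \<inter> \<Union>((`) f ` Q) = {}"
      using disj sub by blast
    \<comment> \<open>A subfamily of a disjoint family is disjoint; conversely, two disjoint
      families with non-overlapping unions combine into one.\<close>
    ultimately have "disjoint (extend Q) \<longleftrightarrow> disjoint ((`) f ` Q)"
      unfolding extend_def by (meson Un_upper2 disjoint_union pairwise_subset)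
    also have "\<dots> \<longleftrightarrow> disjoint Q"
      using inj by (simp add: disjoint_def inj_image_eq_iff image_Int[symmetric])
    finally show ?thesis .
  qed
  ultimately show ?thesis
    by (simp add: partition_on_def)
qed

lemma connected_coalition_partition_extend_iff:
  assumes "\<Union>Q \<subseteq> pverts H"
  shows "connected_coalition_partition J (extend Q) \<longleftrightarrow> connected_coalition_partition H Q"
proof -
  have sub: "A \<subseteq> pverts H" if "A \<in> Q" for A
    using that assms by blast
  have "(\<exists>v. full_vertex J v \<and> f ` A = {v}) \<longleftrightarrow> (\<exists>v. full_vertex H v \<and> A = {v})"
    if "A \<in> Q" for A
  proof
    assume "\<exists>v. full_vertex J v \<and> f ` A = {v}"
    then obtain v where v: "full_vertex J v" "f ` A = {v}" by blast
    then obtain x where "x \<in> A" "v = f x" by blast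
    \<comment> \<open>Both sides are now images under \<open>f\<close>, so injectivity can be
      applied.\<close>
    then have "f ` A = f ` {x}" using v by simp
    then have "A = {x}" using inj by (simp only: inj_image_eq_iff)
    then show "\<exists>v. full_vertex H v \<and> A = {v}"
      using v \<open>v = f x\<close> sub[OF that] full_vertex_image_iff by auto
  next
    assume "\<exists>v. full_vertex H v \<and> A = {v}"
    then show "\<exists>v. full_vertex J v \<and> f ` A = {v}"
      using sub[OF that] full_vertex_image_iff by auto
  qed
  moreover have "(\<exists>B \<in> extend Q. B \<noteq> f ` A \<and> connected_coalition J (f ` A) B) \<longleftrightarrow>
      (\<exists>B \<in> Q. B \<noteq> A \<and> connected_coalition H A B)" if "A \<in> Q" for A
    using sub[OF that] sub connected_coalition_image_iff not_connected_coalition_full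
    by (auto simp: extend_def bex_Un inj_image_eq_iff[OF inj])
  ultimately show ?thesis
    unfolding connected_coalition_partition_def partition_on_extend_iff[OF assms]
    using full by (auto simp: extend_def ball_Un)
qed

lemma connected_coalition_partition_obtain_extend:
  assumes P: "connected_coalition_partition J P"
  shows "\<exists>Q. connected_coalition_partition H Q \<and> P = extend Q"
proof -
  define Q where "Q = {S. S \<subseteq> pverts H \<and> f ` S \<in> P}"
  have U: "{u} \<in> P" if "u \<in> U" for u
    using connected_coalition_partition_full_vertex[OF J P full[OF that]] .
  have part: "partition_on (pverts J) P"
    using P by (simp add: connected_coalition_partition_def)
  have "A \<in> extend Q" if A: "A \<in> P" for A
  proof (cases "A \<inter> U = {}")
    case True
    then have "A \<subseteq> f ` pverts H"
      using A part by (auto simp: partition_on_def verts)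
    then obtain S where "S \<subseteq> pverts H" "A = f ` S"
      by (meson subset_imageE)
    with A show ?thesis by (auto simp: extend_def Q_def)
  next
    case False
    then obtain u where u: "u \<in> U" "u \<in> A" by blast
    \<comment> \<open>\<open>{u}\<close> is also a class and shares \<open>u\<close> with
      \<open>A\<close>.\<close>
    then have "A = {u}"
      using A U part by (fastforce simp: partition_on_def disjoint_def)
    with u show ?thesis by (auto simp: extend_def)
  qed
  then have "P = extend Q"
    using U by (auto simp: extend_def Q_def)
  moreover have "\<Union>Q \<subseteq> pverts H"
    by (auto simp: Q_def)
  ultimately show ?thesis
    using P connected_coalition_partition_extend_iff by blast
qed

lemma connected_coalition_partitions_eq:
  "{P. connected_coalition_partition J P} = extend ` {Q. connected_coalition_partition H Q}"
proof -
  have "connected_coalition_partition J (extend Q)" if "connected_coalition_partition H Q" for Q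
  proof -
    have "\<Union>Q \<subseteq> pverts H"
      using that by (auto simp: connected_coalition_partition_def partition_on_def)
    with that show ?thesis
      by (simp add: connected_coalition_partition_extend_iff)
  qed
  then show ?thesis
    using connected_coalition_partition_obtain_extend by blast
qed

lemma card_extend:
  assumes "connected_coalition_partition H Q"
  shows "card (extend Q) = card Q + card U"
proof -
  have part: "partition_on (pverts H) Q"
    using assms by (simp add: connected_coalition_partition_def)
  have "finite U"
    using simple_graphD(1)[OF J] by (simp add: verts)
  moreover have "finite Q"
    using finite_elements[OF simple_graphD(1)[OF H] part] .
  \<comment> \<open>An equality \<open>{u} = f\<close>
    X\<open>with\<close>X\<open>in\<close>Q\<open>would put\<close>u\<open>into\<close>f
    \<open>pverts H\<close>.\<close>
  moreover have "(\<lambda>u. {u}) ` U \<inter> (`) f ` Q = {}"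
    using part disj by (fastforce simp: partition_on_def)
  moreover have "card ((`) f ` Q) = card Q"
    using inj by (intro card_image) (auto simp: inj_on_def inj_image_eq_iff)
  moreover have "card ((\<lambda>u. {u}) ` U) = card U"
    by (simp add: card_image)
  ultimately show ?thesis
    unfolding extend_def by (simp add: card_Un_disjoint)
qed

text \<open>Extension raises every cardinality by \<open>card U\<close>, hence also the maximum. The
  value 0 is separate because it is a default, not a maximum, and is not shifted.\<close>

lemma connected_coalition_number_extension:
  "connected_coalition_number J =
    (if connected_coalition_number H = 0 then 0 else connected_coalition_number H + card U)"
proof (cases "\<exists>Q. connected_coalition_partition H Q")
  case True
  let ?X = "{Q. connected_coalition_partition H Q}"
  have "card ` {P. connected_coalition_partition J P} = (\<lambda>Q. card Q + card U) ` ?X"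
    unfolding connected_coalition_partitions_eq image_image
    by (intro image_cong) (auto simp: card_extend)
  moreover have "Max ((\<lambda>Q. card Q + card U) ` ?X) = Max (card ` ?X) + card U"
    using True finite_connected_coalition_partitions[OF H] by (intro Max_add_commute) auto
  moreover have "\<exists>P. connected_coalition_partition J P"
    using True connected_coalition_partitions_eq by blast
  ultimately show ?thesis
    using True connected_coalition_number_eq_0_iff[OF H]
    by (simp add: connected_coalition_number_def)
next
  case False
  then have "\<nexists>P. connected_coalition_partition J P"
    using connected_coalition_partitions_eq by blast
  with False show ?thesis
    by (simp add: connected_coalition_number_def)
qed

end

section \<open>Graph joins and the case distinction on completeness\<close>

lemma pverts_graph_join: "pverts (graph_join G H) = Inl ` pverts G \<union> Inr ` pverts H"
  by (auto simp: graph_join_def)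

lemma parcs_graph_join:
  "(Inl x, Inl y) \<in> parcs (graph_join G H) \<longleftrightarrow> (x, y) \<in> parcs G"
  "(Inr z, Inr w) \<in> parcs (graph_join G H) \<longleftrightarrow> (z, w) \<in> parcs H"
  "(Inl x, Inr z) \<in> parcs (graph_join G H) \<longleftrightarrow> x \<in> pverts G \<and> z \<in> pverts H"
  "(Inr z, Inl x) \<in> parcs (graph_join G H) \<longleftrightarrow> x \<in> pverts G \<and> z \<in> pverts H"
  by (auto simp: graph_join_def intro: rev_image_eqI)

lemma simple_graph_join:
  assumes "simple_graph G" "simple_graph H"
  shows "simple_graph (graph_join G H)"
proof (rule simple_graphI)
  note GH = simple_graphD[OF assms(1)] simple_graphD[OF assms(2)]
  show "finite (pverts (graph_join G H))" "pverts (graph_join G H) \<noteq> {}"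
    using GH by (auto simp: pverts_graph_join)
  fix u v assume "(u, v) \<in> parcs (graph_join G H)"
  then show "u \<in> pverts (graph_join G H) \<and> v \<in> pverts (graph_join G H) \<and> u \<noteq> v \<and>
      (v, u) \<in> parcs (graph_join G H)"
    using GH by (cases u; cases v) (auto simp: parcs_graph_join pverts_graph_join)
qed

text \<open>All cross edges are present, so fullness is decided within the vertex's own
  side.\<close>

lemma full_vertex_graph_join:
  assumes "simple_graph G" "simple_graph H"
  shows "full_vertex (graph_join G H) (Inl x) \<longleftrightarrow> full_vertex G x"
    and "full_vertex (graph_join G H) (Inr z) \<longleftrightarrow> full_vertex H z"
  by (auto simp: full_vertex_iff assms simple_graph_join pverts_graph_join parcs_graph_join ball_Un)

text \<open>The two vertices are adjacent, and each dominates the whole opposite side.\<close>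

lemma connected_dominating_set_graph_join:
  assumes "simple_graph G" "simple_graph H" "x \<in> pverts G" "z \<in> pverts H"
  shows "connected_dominating_set (graph_join G H) {Inl x, Inr z}"
proof -
  let ?J = "graph_join G H" and ?S = "{Inl x, Inr z}"
  have "(Inl x, Inr z) \<in> rtrancl_on ?S (parcs ?J)" "(Inr z, Inl x) \<in> rtrancl_on ?S (parcs ?J)"
    by (rule rtrancl_on_into_rtrancl_on[OF rtrancl_on_refl];
        use assms in \<open>simp add: parcs_graph_join\<close>)+
  then show ?thesis
    using assms
    by (auto simp: connected_dominating_set_iff simple_graph_join pverts_graph_join
        parcs_graph_join)
qed

lemma connected_coalition_number_join_not_complete:
  assumes G: "simple_graph G" "\<not> complete_graph G" and H: "simple_graph H" "\<not> complete_graph H"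
  shows "connected_coalition_number (graph_join G H) = card (pverts G) + card (pverts H)"
proof -
  let ?J = "graph_join G H"
  note J = simple_graph_join[OF G(1) H(1)]
  \<comment> \<open>These fixed vertices serve as partners: \<open>z\<close> for every non-full
    vertex of \<open>G\<close>, and \<open>x\<close> for every non-full vertex of
    \<open>H\<close>.\<close>
  obtain x z where x: "x \<in> pverts G" "\<not> full_vertex G x" and z: "z \<in> pverts H" "\<not> full_vertex H z"
    using G(2) H(2) complete_graph_iff[OF G(1)] complete_graph_iff[OF H(1)] by blast
  have "connected_coalition_partition ?J ((\<lambda>v. {v}) ` pverts ?J)"
  proof (rule connected_coalition_partition_singletons[OF J])
    fix v assume v: "v \<in> pverts ?J" "\<not> full_vertex ?J v"
    show "\<exists>w \<in> pverts ?J. \<not> full_vertex ?J w \<and> connected_dominating_set ?J {v, w}"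
    proof (cases v)
      case (Inl y)
      then have "connected_dominating_set ?J {v, Inr z}"
        using v z connected_dominating_set_graph_join[OF G(1) H(1)]
        by (auto simp: pverts_graph_join)
      with z show ?thesis
        using full_vertex_graph_join[OF G(1) H(1)] by (auto simp: pverts_graph_join)
    next
      case (Inr y)
      then have "connected_dominating_set ?J {v, Inl x}"
        using v x connected_dominating_set_graph_join[OF G(1) H(1)]
        by (auto simp: pverts_graph_join insert_commute)
      with x show ?thesis
        using full_vertex_graph_join[OF G(1) H(1)] by (auto simp: pverts_graph_join)
    qed
  qed
  then have "connected_coalition_number ?J = card (Inl ` pverts G \<union> Inr ` pverts H)"
    using connected_coalition_number_eq_card[OF J] by (simp add: pverts_graph_join)
  also have "\<dots> = card (pverts G) + card (pverts H)"
    using simple_graphD(1)[OF G(1)] simple_graphD(1)[OF H(1)]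
    by (subst card_Un_disjoint) (auto simp: card_image)
  finally show ?thesis .
qed

lemma connected_coalition_number_join_complete_left:
  assumes G: "simple_graph G" "complete_graph G" and H: "simple_graph H"
  shows "connected_coalition_number (graph_join G H) =
    (if connected_coalition_number H = 0 then 0
     else connected_coalition_number G + connected_coalition_number H)"
proof -
  interpret full_extension "graph_join G H" H Inr "Inl ` pverts G"
    using G H complete_graph_iff[OF G(1)]
    by unfold_locales
      (auto simp: simple_graph_join pverts_graph_join parcs_graph_join full_vertex_graph_join)
  show ?thesis
    using connected_coalition_number_extension
      connected_coalition_number_complete_graph[OF assms(1,2)]
    by (simp add: card_image)
qed

lemma connected_coalition_number_join_complete_right:
  assumes G: "simple_graph G" and H: "simple_graph H" "complete_graph H"
  shows "connected_coalition_number (graph_join G H) =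
    (if connected_coalition_number G = 0 then 0
     else connected_coalition_number G + connected_coalition_number H)"
proof -
  interpret full_extension "graph_join G H" G Inl "Inr ` pverts H"
    using G H complete_graph_iff[OF H(1)]
    by unfold_locales
      (auto simp: simple_graph_join pverts_graph_join parcs_graph_join full_vertex_graph_join)
  show ?thesis
    using connected_coalition_number_extension
      connected_coalition_number_complete_graph[OF assms(2,3)]
    by (simp add: card_image)
qed

theorem theorem1p9:
  fixes G :: "'a pair_pre_digraph" and H :: "'b pair_pre_digraph"
  assumes "simple_graph G" and "simple_graph H"
  shows
    "(\<not> complete_graph G \<and> \<not> complete_graph H \<longrightarrow>
        connected_coalition_number (graph_join G H) = card (pverts G) + card (pverts H)) \<and>
     ((complete_graph G \<and> connected_coalition_number H = 0) \<or>
      (complete_graph H \<and> connected_coalition_number G = 0) \<longrightarrow>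
        connected_coalition_number (graph_join G H) = 0) \<and>
     (\<not> (\<not> complete_graph G \<and> \<not> complete_graph H) \<and>
      \<not> ((complete_graph G \<and> connected_coalition_number H = 0) \<or>
         (complete_graph H \<and> connected_coalition_number G = 0)) \<longrightarrow>
        connected_coalition_number (graph_join G H) =
          connected_coalition_number G + connected_coalition_number H)"
  \<comment> \<open>With a complete factor, whether the other factor's number is 0 separates the
    last two clauses.\<close>
  using assms connected_coalition_number_join_not_complete[of G H]
    connected_coalition_number_join_complete_left[of G H]
    connected_coalition_number_join_complete_right[of G H]
  by auto

end
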